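(* Consider the biobjective mixed-integer linear program of minimizing $\boldsymbol f(x)=(f_1(x),f_2(x))$, $f_k(x)=\sum_j c^k_jx_j$, over $X_I$, with set of efficient points $X_E$ and set of nondominated points $Y_N$ (all as defined in the context). Let $x_i$ and $x_j$ be two variables, either both integer or both continuous, such that $x_j$ dominates $x_i$, i.e. $c^k_j\le c^k_i$ for all $k\in\{1,2\}$ and $a_{rj}\le a_{ri}$ for every row $r$ of $A$. Then $$Y_N=\{\boldsymbol f(x) : x\in X_E,\ x_i=l_i\text{ or }x_j=u_j\}\subseteq\{\boldsymbol f(x) : x\in X_I,\ x_i=l_i\text{ or }x_j=u_j\}.$$
   Context: Let $X_I=\{x\in\mathbb Z^n_{+}\times\mathbb R^p_{+} : Ax\le b,\ l_i\le x_i\le u_i\ \forall i\}$, where $A=(a_{ij})$ is a real matrix and $b$ a real vector; $x_i$ is an integer variable if $i\le n$ and a continuous variable otherwise. The only assumption on the model is that $X_I\neq\emptyset$ and $-\infty<l_i<u_i<+\infty$ for all $i$. The two objectives are $f_k(x)=(c^k)^{\mathsf T}x$, $k=1,2$, where $c^k\in\mathbb R^{n+p}$ has $j$-th entry $c^k_j$, and $\boldsymbol f(x)=(f_1(x),f_2(x))\in\mathbb R^2$. For $y,y'\in\mathbb R^2$, $y$ dominates $y'$ (written $y\succ y'$) if $y\le y'$ componentwise. A point $x\in X_I$ is efficient if there is no $x'\in X_I$ with $\boldsymbol f(x')\succ\boldsymbol f(x)$ and $\boldsymbol f(x')\neq\boldsymbol f(x)$. $X_E$ is the set of efficient points and $Y_N=\boldsymbol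 f(X_E)$ is the set of nondominated points. (Domination between variables, defined in the claim, is unrelated to domination between points of $\mathbb R^2$.)
   Formalization: The formal theorem additionally assumes that l_i is nonnegative and, when x_i and x_j are integer variables, that l_i and u_j are integers; without these conditions the claim is false. The two variables are taken to be distinct. *)

theory Defs
  imports "Jordan_Normal_Form.Matrix"
begin

(* Indices are 0-based: of the n + p variables, those with index < n are integer
   variables, the others are continuous. The order on vectors is componentwise. *)
definition feasible_set ::
  "nat \<Rightarrow> nat \<Rightarrow> real mat \<Rightarrow> real vec \<Rightarrow> real vec \<Rightarrow> real vec \<Rightarrow> real vec set" where
  "feasible_set n p A b l u =
     {x \<in> carrier_vec (n + p).
        (\<forall>i<n. x $ i \<in> \<int>) \<and> 0\<^sub>v (n + p) \<le> x \<and> A *\<^sub>v x \<le> b \<and> l \<le> x \<and> x \<le> u}"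

definition objectives :: "real vec \<Rightarrow> real vec \<Rightarrow> real vec \<Rightarrow> real \<times> real" where
  "objectives c1 c2 x = (c1 \<bullet> x, c2 \<bullet> x)"

(* Reflexive: every point dominates itself. *)
definition dominates :: "real \<times> real \<Rightarrow> real \<times> real \<Rightarrow> bool" (infix "\<succ>" 50) where
  "y \<succ> y' \<longleftrightarrow> fst y \<le> fst y' \<and> snd y \<le> snd y'"

definition efficient_set :: "('a \<Rightarrow> real \<times> real) \<Rightarrow> 'a set \<Rightarrow> 'a set" where
  "efficient_set f X = {x \<in> X. \<not> (\<exists>x'\<in>X. f x' \<succ> f x \<and> f x' \<noteq> f x)}"

definition nondominated_set :: "('a \<Rightarrow> real \<times> real) \<Rightarrow> 'a set \<Rightarrow> (real \<times> real) set" where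
  "nondominated_set f X = f ` efficient_set f X"

definition var_dominates ::
  "real mat \<Rightarrow> real vec \<Rightarrow> real vec \<Rightarrow> nat \<Rightarrow> nat \<Rightarrow> bool" where
  "var_dominates A c1 c2 j i \<longleftrightarrow>
     c1 $ j \<le> c1 $ i \<and> c2 $ j \<le> c2 $ i \<and> (\<forall>r<dim_row A. A $$ (r, j) \<le> A $$ (r, i))"

end

theory Submission
  imports Defs
begin

text \<open>
  Moving the amount \<open>t = min (x\<^sub>i - l\<^sub>i) (u\<^sub>j - x\<^sub>j)\<close> from the dominated variable \<open>x\<^sub>i\<close> to the dominating
  variable \<open>x\<^sub>j\<close> keeps a point feasible, worsens neither objective, and makes one of the two bounds
  tight. If the point was efficient, its image cannot change, so the shifted point is efficient
  with the same image.
\<close>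

text \<open>Writing the shift as a step along the direction \<open>e_j - e_i\<close>, rather than as
  an entrywise update, lets distributivity of the scalar product compute its effect on every linear
  form.\<close>

definition shift_vec :: "nat \<Rightarrow> nat \<Rightarrow> nat \<Rightarrow> 'a :: ring_1 \<Rightarrow> 'a vec \<Rightarrow> 'a vec" where
  "shift_vec N i j t x = x + t \<cdot>\<^sub>v (unit_vec N j - unit_vec N i)"

lemma shift_vec_carrier [simp]:
  "x \<in> carrier_vec N \<Longrightarrow> shift_vec N i j t x \<in> carrier_vec N"
  by (simp add: shift_vec_def)

lemma shift_vec_index:
  assumes "k < N" "i \<noteq> j"
  shows "shift_vec N i j t x $ k =
    (if k = i then x $ k - t else if k = j then x $ k + t else x $ k)"
  using assms by (simp add: shift_vec_def unit_vec_def)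

lemma scalar_prod_shift_vec:
  fixes c :: "'a :: comm_ring_1 vec"
  assumes "c \<in> carrier_vec N" "x \<in> carrier_vec N" "i < N" "j < N"
  shows "c \<bullet> shift_vec N i j t x = c \<bullet> x + t * (c $ j - c $ i)"
  using assms unfolding shift_vec_def
  by (simp add: scalar_prod_add_distrib[of _ N] scalar_prod_minus_distrib[of _ N])

lemma scalar_prod_shift_vec_le:
  fixes c :: "'a :: linordered_idom vec"
  assumes "c \<in> carrier_vec N" "x \<in> carrier_vec N" "i < N" "j < N"
    and "0 \<le> t" "c $ j \<le> c $ i"
  shows "c \<bullet> shift_vec N i j t x \<le> c \<bullet> x"
  using assms by (simp add: scalar_prod_shift_vec mult_nonneg_nonpos)

text \<open>Each row of \<open>A\<close> is a linear form whose coefficient at \<open>j\<close> is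
  at most that at \<open>i\<close>, so the scalar product bound applies row by row.\<close>

lemma mult_mat_shift_vec_le:
  fixes A :: "'a :: linordered_idom mat"
  assumes "A \<in> carrier_mat m N" "x \<in> carrier_vec N" "i < N" "j < N"
    and "0 \<le> t" "\<And>r. r < m \<Longrightarrow> A $$ (r, j) \<le> A $$ (r, i)"
  shows "A *\<^sub>v shift_vec N i j t x \<le> A *\<^sub>v x"
  using assms by (auto simp: less_eq_vec_def intro!: scalar_prod_shift_vec_le)

lemma shift_vec_feasible:
  assumes A: "A \<in> carrier_mat m (n + p)"
    and x: "x \<in> feasible_set n p A b l u"
    and ij: "i < n + p" "j < n + p" "i \<noteq> j"
    and dom: "\<And>r. r < m \<Longrightarrow> A $$ (r, j) \<le> A $$ (r, i)"
    and t: "0 \<le> t" "t \<le> x $ i - l $ i" "t \<le> u $ j - x $ j"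
    and t_int: "i < n \<or> j < n \<Longrightarrow> t \<in> \<int>"
    and "0 \<le> l $ i"
  shows "shift_vec (n + p) i j t x \<in> feasible_set n p A b l u"
proof -
  let ?x = "shift_vec (n + p) i j t x"
  have xc: "x \<in> carrier_vec (n + p)" and int: "\<And>k. k < n \<Longrightarrow> x $ k \<in> \<int>"
    and nonneg: "\<And>k. k < n + p \<Longrightarrow> 0 \<le> x $ k"
    and Ax: "A *\<^sub>v x \<le> b" and "l \<le> x" "x \<le> u"
    using x by (auto simp: feasible_set_def less_eq_vec_def)
  then have dims: "dim_vec l = n + p" "dim_vec u = n + p"
    and bounds: "\<And>k. k < n + p \<Longrightarrow> l $ k \<le> x $ k \<and> x $ k \<le> u $ k"
    by (auto simp: less_eq_vec_def)
  have "A *\<^sub>v ?x \<le> b"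
    using mult_mat_shift_vec_le[OF A xc ij(1,2) t(1) dom] Ax by (rule order_trans)
  \<comment> \<open>Only entries \<open>i\<close> and \<open>j\<close> change, so \<open>t\<close>
    has to be integral only if one of them is an integer variable.\<close>
  moreover have "?x $ k \<in> \<int>" if "k < n" for k
    using that int[OF that] t_int ij by (auto simp: shift_vec_index)
  \<comment> \<open>The decreased entry stays nonnegative because it remains above
    \<open>l $ i\<close>, which is itself nonnegative.\<close>
  moreover have "0 \<le> ?x $ k \<and> l $ k \<le> ?x $ k \<and> ?x $ k \<le> u $ k" if "k < n + p" for k
    using that nonneg[OF that] bounds[OF that] t \<open>0 \<le> l $ i\<close> ij
    by (auto simp: shift_vec_index)
  moreover have "?x \<in> carrier_vec (n + p)"
    using xc by simp
  ultimately show ?thesis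
    using dims by (auto simp: feasible_set_def less_eq_vec_def)
qed

text \<open>A feasible point with a different, dominating image would contradict efficiency of
  \<open>x\<close>. Efficiency depends on a feasible point only through its image, so it passes to
  \<open>x'\<close>.\<close>

lemma efficient_set_dominating:
  assumes "x \<in> efficient_set f X" "x' \<in> X" "f x' \<succ> f x"
  shows "f x' = f x" "x' \<in> efficient_set f X"
proof -
  show "f x' = f x"
    using assms by (auto simp: efficient_set_def)
  then show "x' \<in> efficient_set f X"
    using assms by (simp add: efficient_set_def)
qed

text \<open>\<open>lower_nonneg\<close> and \<open>integral_bounds\<close> make the bounds
  reachable: a nonnegative variable never attains a negative bound, and an integer variable never
  attains a fractional one.\<close>

theorem proposition3:
  fixes n p m i j :: nat
    and A :: "real mat" and b l u c1 c2 :: "real vec"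
  defines "XI \<equiv> feasible_set n p A b l u"
    and "f \<equiv> objectives c1 c2"
  assumes "A \<in> carrier_mat m (n + p)" and "b \<in> carrier_vec m"
    and "l \<in> carrier_vec (n + p)" and "u \<in> carrier_vec (n + p)"
    and "c1 \<in> carrier_vec (n + p)" and "c2 \<in> carrier_vec (n + p)"
    and "XI \<noteq> {}"
    and "\<And>k. k < n + p \<Longrightarrow> l $ k < u $ k"
    and "i < n + p" and "j < n + p" and "i \<noteq> j"
    and same_kind: "i < n \<longleftrightarrow> j < n"
    and lower_nonneg: "0 \<le> l $ i"
    and integral_bounds: "i < n \<Longrightarrow> l $ i \<in> \<int> \<and> u $ j \<in> \<int>"
    and "var_dominates A c1 c2 j i"
  shows "nondominated_set f XI = {f x | x. x \<in> efficient_set f XI \<and> (x $ i = l $ i \<or> x $ j = u $ j)}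
       \<and> {f x | x. x \<in> efficient_set f XI \<and> (x $ i = l $ i \<or> x $ j = u $ j)}
           \<subseteq> {f x | x. x \<in> XI \<and> (x $ i = l $ i \<or> x $ j = u $ j)}"
proof -
  let ?tight = "\<lambda>x. x $ i = l $ i \<or> x $ j = u $ j"
  have dom: "c1 $ j \<le> c1 $ i" "c2 $ j \<le> c2 $ i" "\<And>r. r < m \<Longrightarrow> A $$ (r, j) \<le> A $$ (r, i)"
    using \<open>var_dominates A c1 c2 j i\<close> \<open>A \<in> carrier_mat m (n + p)\<close>
    by (auto simp: var_dominates_def)
  have shift: "\<exists>x'. x' \<in> efficient_set f XI \<and> f x' = f x \<and> ?tight x'"
    if x: "x \<in> efficient_set f XI" for x
  proof -
    define t where "t = min (x $ i - l $ i) (u $ j - x $ j)"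
    let ?x = "shift_vec (n + p) i j t x"
    have xX: "x \<in> feasible_set n p A b l u"
      using x by (simp add: efficient_set_def XI_def)
    then have xc: "x \<in> carrier_vec (n + p)" and x_int: "\<And>k. k < n \<Longrightarrow> x $ k \<in> \<int>"
      and "l \<le> x" "x \<le> u"
      by (auto simp: feasible_set_def)
    then have t: "0 \<le> t"
      using \<open>i < n + p\<close> \<open>j < n + p\<close> by (auto simp: t_def less_eq_vec_def)
    \<comment> \<open>By \<open>same_kind\<close> both variables are then integer, so both arguments
      of the minimum are differences of integers.\<close>
    have "t \<in> \<int>" if "i < n \<or> j < n"
      using that same_kind integral_bounds x_int by (auto simp: t_def min_def)
    then have "?x \<in> XI"
      unfolding XI_def
      using \<open>A \<in> carrier_mat m (n + p)\<close> xX \<open>i < n + p\<close> \<open>j < n + p\<close> \<open>i \<noteq> j\<close> dom(3) t lower_nonneg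
      by (intro shift_vec_feasible) (auto simp: t_def)
    moreover have "f ?x \<succ> f x"
      using \<open>c1 \<in> carrier_vec (n + p)\<close> \<open>c2 \<in> carrier_vec (n + p)\<close> xc \<open>i < n + p\<close> \<open>j < n + p\<close> t dom
      by (simp add: f_def objectives_def dominates_def scalar_prod_shift_vec_le)
    \<comment> \<open>The argument at which the minimum \<open>t\<close> is attained decides which
      bound becomes tight.\<close>
    moreover have "?tight ?x"
      using \<open>i < n + p\<close> \<open>j < n + p\<close> \<open>i \<noteq> j\<close> by (auto simp: shift_vec_index t_def min_def)
    ultimately show ?thesis
      using efficient_set_dominating[OF x] by blast
  qed
  have "nondominated_set f XI = {f x | x. x \<in> efficient_set f XI \<and> ?tight x}"
  proof
    \<comment> \<open>An efficient preimage may fail to be tight; \<open>shift\<close> replaces it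
      by a tight efficient one with the same image.\<close>
    show "nondominated_set f XI \<subseteq> {f x | x. x \<in> efficient_set f XI \<and> ?tight x}"
      unfolding nondominated_set_def using shift by (smt (verit) imageE mem_Collect_eq subsetI)
    show "{f x | x. x \<in> efficient_set f XI \<and> ?tight x} \<subseteq> nondominated_set f XI"
      by (auto simp: nondominated_set_def)
  qed
  moreover have "efficient_set f XI \<subseteq> XI"
    by (auto simp: efficient_set_def)
  ultimately show ?thesis
    by blast
qed

end
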